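(* Let $X$ be a space of analytic functions on $\mathbb{D}$ that is a Banach algebra under the Duhamel product $\circledast$ and contains the identity function $z$. Let $\varphi$ be an analytic self-map of $\mathbb{D}$ such that the composition operator $C_\varphi$ is a bounded operator on $X$. Then $C_\varphi$ is Duhamel multiplicative on $X$ if and only if $\varphi(z)=az$ for some $a\in\mathbb{C}$ with $|a|\leq1$.
   Context: $\mathbb{D}$ is the open unit disc in $\mathbb{C}$. The Duhamel product of analytic functions $f,g$ on $\mathbb{D}$ is $(f\circledast g)(z)=\frac{d}{dz}\int_0^z f(z-t)g(t)\,dt=\int_0^z f'(z-t)g(t)\,dt+f(0)g(z)$. For an analytic map $\varphi:\mathbb{D}\to\mathbb{D}$, $C_\varphi f=f\circ\varphi$. An operator $T:X\to X$ is Duhamel multiplicative on $X$ if $T(f\circledast g)=Tf\circledast Tg$ for all $f,g\in X$. *)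

theory Defs
  imports "HOL-Complex_Analysis.Complex_Analysis"
begin

text \<open>A function on the open unit disc is represented by its extension by \<open>0\<close> to the whole plane,
  so that two functions on the disc agree iff their representatives are equal.\<close>

definition on_disc :: "(complex \<Rightarrow> complex) \<Rightarrow> complex \<Rightarrow> complex" where
  "on_disc f = (\<lambda>z. if z \<in> ball 0 1 then f z else 0)"

definition duhamel :: "(complex \<Rightarrow> complex) \<Rightarrow> (complex \<Rightarrow> complex) \<Rightarrow> complex \<Rightarrow> complex"
    (infixl "\<circledast>" 70) where
  "f \<circledast> g = on_disc (deriv (\<lambda>z. contour_integral (linepath 0 z) (\<lambda>t. f (z - t) * g t)))"

definition comp_op :: "(complex \<Rightarrow> complex) \<Rightarrow> (complex \<Rightarrow> complex) \<Rightarrow> complex \<Rightarrow> complex" where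
  "comp_op \<phi> f = on_disc (f \<circ> \<phi>)"

text \<open>A complex Banach space \<open>X\<close> of analytic functions on the disc, with norm \<open>N\<close>, that is closed under
  the Duhamel product with submultiplicative norm. Bilinearity, associativity and commutativity of
  the product hold for all analytic functions and are therefore not listed. No unit is required,
  and \<open>N\<close> is unconstrained outside \<open>X\<close>.\<close>

locale duhamel_banach_algebra =
  fixes X :: "(complex \<Rightarrow> complex) set" and N :: "(complex \<Rightarrow> complex) \<Rightarrow> real"
  assumes holomorphic: "f \<in> X \<Longrightarrow> f holomorphic_on ball 0 1"
    and zero_outside: "f \<in> X \<Longrightarrow> z \<notin> ball 0 1 \<Longrightarrow> f z = 0"
    and zero_mem: "(\<lambda>z. 0) \<in> X"
    and add_mem: "f \<in> X \<Longrightarrow> g \<in> X \<Longrightarrow> (\<lambda>z. f z + g z) \<in> X"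
    and scale_mem: "f \<in> X \<Longrightarrow> (\<lambda>z. c * f z) \<in> X"
    and norm_nonneg: "f \<in> X \<Longrightarrow> N f \<ge> 0"
    and norm_eq_0_iff: "f \<in> X \<Longrightarrow> N f = 0 \<longleftrightarrow> f = (\<lambda>z. 0)"
    and norm_triangle: "f \<in> X \<Longrightarrow> g \<in> X \<Longrightarrow> N (\<lambda>z. f z + g z) \<le> N f + N g"
    and norm_scale: "f \<in> X \<Longrightarrow> N (\<lambda>z. c * f z) = cmod c * N f"
    and complete: "(\<And>n. s n \<in> X) \<Longrightarrow>
        (\<And>e. e > 0 \<Longrightarrow> \<exists>M. \<forall>m\<ge>M. \<forall>n\<ge>M. N (\<lambda>z. s m z - s n z) < e) \<Longrightarrow>
        \<exists>f\<in>X. (\<lambda>n::nat. N (\<lambda>z. s n z - f z)) \<longlonglongrightarrow> 0"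
    and duhamel_mem: "f \<in> X \<Longrightarrow> g \<in> X \<Longrightarrow> f \<circledast> g \<in> X"
    and norm_duhamel: "f \<in> X \<Longrightarrow> g \<in> X \<Longrightarrow> N (f \<circledast> g) \<le> N f * N g"

definition bounded_operator_on ::
    "(complex \<Rightarrow> complex) set \<Rightarrow> ((complex \<Rightarrow> complex) \<Rightarrow> real) \<Rightarrow>
     ((complex \<Rightarrow> complex) \<Rightarrow> (complex \<Rightarrow> complex)) \<Rightarrow> bool" where
  "bounded_operator_on X N T \<longleftrightarrow>
     (\<forall>f\<in>X. T f \<in> X) \<and>
     (\<forall>f\<in>X. \<forall>g\<in>X. T (\<lambda>z. f z + g z) = (\<lambda>z. T f z + T g z)) \<and>
     (\<forall>c. \<forall>f\<in>X. T (\<lambda>z. c * f z) = (\<lambda>z. c * T f z)) \<and>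
     (\<exists>C. \<forall>f\<in>X. N (T f) \<le> C * N f)"

definition duhamel_multiplicative_on ::
    "(complex \<Rightarrow> complex) set \<Rightarrow> ((complex \<Rightarrow> complex) \<Rightarrow> (complex \<Rightarrow> complex)) \<Rightarrow> bool" where
  "duhamel_multiplicative_on X T \<longleftrightarrow> (\<forall>f\<in>X. \<forall>g\<in>X. T (f \<circledast> g) = T f \<circledast> T g)"

end

theory Submission imports Defs begin

text \<open>Writing the convolution integral as \<open>z\<close> times an integral over \<open>[0, 1]\<close>, one obtains
  \<open>(f \<circledast> g)' = f' \<circledast> g + f(0) g'\<close>, so the \<open>n\<close>-th derivative of \<open>f \<circledast> g\<close> at \<open>0\<close> is the Cauchy
  product of the derivatives of \<open>f\<close> and \<open>g\<close> at \<open>0\<close>, without binomial coefficients. Since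
  \<open>z \<circledast> z = z\<^sup>2 / 2\<close>, multiplicativity at \<open>(z, z)\<close> says \<open>\<phi>\<^sup>2 = 2 (\<phi> \<circledast> \<phi>)\<close>. Comparing with the
  Leibniz rule for \<open>\<phi>\<^sup>2\<close> yields \<open>\<Sum>i\<le>n. ((n choose i) - 2) c\<^sub>i c\<^bsub>n-i\<^esub> = 0\<close> for the derivatives
  \<open>c\<^sub>i\<close> of \<open>\<phi>\<close> at \<open>0\<close>, and these equations force \<open>c\<^sub>i = 0\<close> for \<open>i \<noteq> 1\<close>.\<close>

section \<open>Convolution over a fixed interval and its derivatives\<close>

text \<open>With \<open>t = s z\<close> the endpoints no longer depend on \<open>z\<close>, so
  differentiation under the integral sign applies, also at \<open>z = 0\<close>.\<close>

definition unit_convolution :: "(complex \<Rightarrow> complex) \<Rightarrow> (complex \<Rightarrow> complex) \<Rightarrow> complex \<Rightarrow> complex" where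
  "unit_convolution f g z =
     integral (cbox 0 1) (\<lambda>s::real. f ((1 - of_real s) * z) * g (of_real s * z))"

lemma contour_convolution_eq:
  "contour_integral (linepath 0 z) (\<lambda>t. f (z - t) * g t) = z * unit_convolution f g z"
proof -
  have "linepath 0 z s = of_real s * z" for s
    by (simp add: linepath_def scaleR_conv_of_real)
  then show ?thesis
    by (simp add: contour_integral_integral unit_convolution_def algebra_simps
        flip: integral_mult_right)
qed

lemma of_real_unit_mult_in_ball:
  fixes z :: complex
  assumes "z \<in> ball 0 r" "s \<in> cbox 0 (1::real)"
  shows "of_real s * z \<in> ball 0 r" "(1 - of_real s) * z \<in> ball 0 r"
proof -
  have *: "of_real u * z \<in> ball 0 r" if "u \<in> cbox 0 (1::real)" for u
    using assms(1) that mult_left_le_one_le[of "norm z" "\<bar>u\<bar>"] by (simp add: norm_mult)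
  show "of_real s * z \<in> ball 0 r" by (rule *[OF assms(2)])
  show "(1 - of_real s) * z \<in> ball 0 r"
    using *[of "1 - s"] assms(2) by simp
qed

lemma unit_convolution_has_field_derivative:
  assumes f: "f holomorphic_on ball 0 r" and g: "g holomorphic_on ball 0 r" and z: "z \<in> ball 0 r"
  shows "(unit_convolution f g has_field_derivative
    integral (cbox 0 1) (\<lambda>s::real. (1 - of_real s) * deriv f ((1 - of_real s) * z) * g (of_real s * z)
      + of_real s * f ((1 - of_real s) * z) * deriv g (of_real s * z))) (at z)"
proof -
  note cont = holomorphic_on_imp_continuous_on[OF f] holomorphic_on_imp_continuous_on[OF g]
    holomorphic_on_imp_continuous_on[OF holomorphic_deriv[OF f open_ball]]
    holomorphic_on_imp_continuous_on[OF holomorphic_deriv[OF g open_ball]]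
  note [continuous_intros] = cont[THEN continuous_on_compose2]
  have "((\<lambda>z. integral (cbox 0 1) (\<lambda>s::real. f ((1 - of_real s) * z) * g (of_real s * z)))
    has_field_derivative
    integral (cbox 0 1) (\<lambda>s::real. (1 - of_real s) * deriv f ((1 - of_real s) * z) * g (of_real s * z)
      + of_real s * f ((1 - of_real s) * z) * deriv g (of_real s * z))) (at z within ball 0 r)"
  proof (rule leibniz_rule_field_derivative[OF _ _ _ z convex_ball])
    fix w :: complex and s :: real assume w: "w \<in> ball 0 r" and s: "s \<in> cbox 0 1"
    note in_ball = of_real_unit_mult_in_ball[OF w s]
    have "(f has_field_derivative deriv f ((1 - of_real s) * w)) (at ((1 - of_real s) * w))"
      "(g has_field_derivative deriv g (of_real s * w)) (at (of_real s * w))"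
      using in_ball f g by (auto intro: holomorphic_derivI)
    note D = this(1)[THEN DERIV_chain2[where g = "\<lambda>z. (1 - of_real s) * z"]]
      this(2)[THEN DERIV_chain2[where g = "\<lambda>z. of_real s * z"]]
    show "((\<lambda>z. f ((1 - of_real s) * z) * g (of_real s * z)) has_field_derivative
        (1 - of_real s) * deriv f ((1 - of_real s) * w) * g (of_real s * w)
        + of_real s * f ((1 - of_real s) * w) * deriv g (of_real s * w)) (at w within ball 0 r)"
      by (auto intro!: derivative_eq_intros D)
  next
    fix w assume w: "w \<in> ball (0::complex) r"
    show "(\<lambda>s::real. f ((1 - of_real s) * w) * g (of_real s * w)) integrable_on cbox 0 1"
      using of_real_unit_mult_in_ball[OF w]
      by (intro integrable_continuous continuous_intros) auto
  next
    show "continuous_on (ball 0 r \<times> cbox 0 1) (\<lambda>(z, s::real).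
        (1 - of_real s) * deriv f ((1 - of_real s) * z) * g (of_real s * z)
        + of_real s * f ((1 - of_real s) * z) * deriv g (of_real s * z))"
      unfolding case_prod_unfold
      using of_real_unit_mult_in_ball
      by (intro continuous_intros) (auto simp del: mem_ball)
  qed
  then show ?thesis
    using z by (simp add: unit_convolution_def[abs_def] at_within_open[OF _ open_ball])
qed

lemma unit_convolution_holomorphic:
  assumes "f holomorphic_on ball 0 r" "g holomorphic_on ball 0 r"
  shows "unit_convolution f g holomorphic_on ball 0 r"
  using unit_convolution_has_field_derivative[OF assms] holomorphic_on_open[OF open_ball] by blast

text \<open>The product rule gives the integral of \<open>?f * ?g + z * ?P\<close>, with derivatives
  on both factors. Subtracting \<open>z * ?f' * ?g\<close> leaves an exact derivative in
  \<open>s\<close>, so integrating it moves every derivative onto \<open>f\<close> at the cost of a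
  boundary term.\<close>

lemma deriv_times_unit_convolution:
  assumes f: "f holomorphic_on ball 0 r" and g: "g holomorphic_on ball 0 r" and z: "z \<in> ball 0 r"
  shows "deriv (\<lambda>z. z * unit_convolution f g z) z
    = z * unit_convolution (deriv f) g z + f 0 * g z"
proof -
  note cont = holomorphic_on_imp_continuous_on[OF f] holomorphic_on_imp_continuous_on[OF g]
    holomorphic_on_imp_continuous_on[OF holomorphic_deriv[OF f open_ball]]
    holomorphic_on_imp_continuous_on[OF holomorphic_deriv[OF g open_ball]]
  note [continuous_intros] = cont[THEN continuous_on_compose2]
  note in_ball = of_real_unit_mult_in_ball[OF z]
  let ?f = "\<lambda>s::real. f ((1 - of_real s) * z)" and ?g = "\<lambda>s::real. g (of_real s * z)"
  let ?f' = "\<lambda>s::real. deriv f ((1 - of_real s) * z)" and ?g' = "\<lambda>s::real. deriv g (of_real s * z)"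
  let ?P = "\<lambda>s::real. (1 - of_real s) * ?f' s * ?g s + of_real s * ?f s * ?g' s"
  let ?Q = "\<lambda>s::real. ?f s * ?g s - of_real s * z * ?f' s * ?g s + of_real s * z * ?f s * ?g' s"
  \<comment> \<open>\<open>?Q\<close> is the derivative in \<open>s\<close> of
    \<open>s * f ((1 - s) * z) * g (s * z)\<close>. The leading factor \<open>s\<close> kills the
    boundary term at 0.\<close>
  have "(?Q has_integral of_real 1 * ?f 1 * ?g 1 - of_real 0 * ?f 0 * ?g 0) {0..1}"
  proof (rule fundamental_theorem_of_calculus)
    fix s :: real assume s: "s \<in> {0..1}"
    have *: "(f has_field_derivative ?f' s) (at ((1 - of_real s) * z))"
      "(g has_field_derivative ?g' s) (at (of_real s * z))"
      using in_ball[of s] s f g by (auto intro: holomorphic_derivI)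
    have D1: "((\<lambda>w. f ((1 - w) * z)) has_field_derivative ?f' s * (- z)) (at (of_real s))"
      by (rule DERIV_chain2[where g = "\<lambda>w. (1 - w) * z", OF *(1)])
        (auto intro!: derivative_eq_intros)
    have D2: "((\<lambda>w. g (w * z)) has_field_derivative ?g' s * z) (at (of_real s))"
      by (rule DERIV_chain2[where g = "\<lambda>w. w * z", OF *(2)])
        (auto intro!: derivative_eq_intros)
    have "((\<lambda>w. w * f ((1 - w) * z) * g (w * z)) has_field_derivative ?Q s) (at (of_real s))"
      by (rule derivative_eq_intros D1 D2 refl)+ (simp add: algebra_simps)
    then show "((\<lambda>s. of_real s * ?f s * ?g s) has_vector_derivative ?Q s) (at s within {0..1})"
      using has_vector_derivative_real_field[of "\<lambda>w. w * f ((1 - w) * z) * g (w * z)"] by simp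
  qed simp
  then have Q: "(?Q has_integral f 0 * g z) (cbox 0 1)" by simp
  have P: "?P integrable_on cbox 0 1" and
    fg: "(\<lambda>s. ?f s * ?g s) integrable_on cbox 0 1" and
    f'g: "(\<lambda>s. ?f' s * ?g s) integrable_on cbox 0 1"
    using in_ball by (intro integrable_continuous continuous_intros; auto simp del: mem_ball)+
  have A: "((\<lambda>s. z * (?f' s * ?g s) + ?Q s) has_integral z * unit_convolution (deriv f) g z + f 0 * g z)
      (cbox 0 1)"
    unfolding unit_convolution_def
    by (intro has_integral_add has_integral_mult_right Q integrable_integral f'g)
  have B: "((\<lambda>s. ?f s * ?g s + z * ?P s) has_integral
      unit_convolution f g z + z * integral (cbox 0 1) ?P) (cbox 0 1)"
    unfolding unit_convolution_def
    by (intro has_integral_add has_integral_mult_right integrable_integral fg P)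
  have "(\<lambda>s. z * (?f' s * ?g s) + ?Q s) = (\<lambda>s. ?f s * ?g s + z * ?P s)"
    by (auto simp: algebra_simps)
  from has_integral_unique[OF B A[unfolded this]]
  have "unit_convolution f g z + z * integral (cbox 0 1) ?P
      = z * unit_convolution (deriv f) g z + f 0 * g z" .
  moreover have "((\<lambda>z. z * unit_convolution f g z) has_field_derivative
      unit_convolution f g z + z * integral (cbox 0 1) ?P) (at z)"
    using DERIV_mult[OF DERIV_ident unit_convolution_has_field_derivative[OF f g z]]
    by (simp add: algebra_simps)
  ultimately show ?thesis
    by (simp add: DERIV_imp_deriv)
qed

text \<open>Induction with \<open>f\<close> varying: each differentiation replaces \<open>f\<close>
  by \<open>deriv f\<close> and splits off \<open>f 0 * g\<close>. Since \<open>g\<close> is never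
  differentiated inside the convolution, no binomial coefficients arise.\<close>

lemma higher_deriv_duhamel_0:
  assumes "f holomorphic_on ball 0 r" "g holomorphic_on ball 0 r" "0 < r"
  shows "(deriv ^^ n) (deriv (\<lambda>z. z * unit_convolution f g z)) 0
    = (\<Sum>i\<le>n. (deriv ^^ i) f 0 * (deriv ^^ (n - i)) g 0)"
  using assms
proof (induction n arbitrary: f)
  case 0
  then show ?case using deriv_times_unit_convolution[of f r g 0] by simp
next
  case (Suc n)
  note f = \<open>f holomorphic_on ball 0 r\<close> and g = \<open>g holomorphic_on ball 0 r\<close>
  have f': "deriv f holomorphic_on ball 0 r" using f by (rule holomorphic_deriv) simp
  note G = unit_convolution_holomorphic[OF f g] unit_convolution_holomorphic[OF f' g]
  have "(deriv ^^ Suc n) (deriv (\<lambda>z. z * unit_convolution f g z)) 0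
    = (deriv ^^ Suc n) (\<lambda>z. z * unit_convolution (deriv f) g z + f 0 * g z) 0"
    using \<open>0 < r\<close> deriv_times_unit_convolution[OF f g]
    by (intro higher_deriv_transform_within_open[where S = "ball 0 r"] holomorphic_intros
        holomorphic_deriv G g) auto
  also have "\<dots> = (deriv ^^ Suc n) (\<lambda>z. z * unit_convolution (deriv f) g z) 0
      + f 0 * (deriv ^^ Suc n) g 0"
    using \<open>0 < r\<close> higher_deriv_cmult[OF g]
    by (subst higher_deriv_add[where S = "ball 0 r"]) (auto intro!: holomorphic_intros G g simp del: funpow.simps)
  \<comment> \<open>One of the \<open>Suc n\<close> derivatives turns
    \<open>z * unit_convolution (deriv f) g z\<close> into the Duhamel product of
    \<open>deriv f\<close> and \<open>g\<close>; the other \<open>n\<close> fall to the induction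
    hypothesis.\<close>
  also have "(deriv ^^ Suc n) (\<lambda>z. z * unit_convolution (deriv f) g z) 0
      = (\<Sum>i\<le>n. (deriv ^^ Suc i) f 0 * (deriv ^^ (n - i)) g 0)"
    using Suc.IH[OF f' g \<open>0 < r\<close>] by (simp add: funpow_Suc_right del: funpow.simps)
  finally show ?case
    by (simp add: sum.atMost_Suc_shift add.commute del: sum.atMost_Suc)
qed

section \<open>The Duhamel product on the disc, and dilations\<close>

lemma duhamel_eq:
  "f \<circledast> g = on_disc (deriv (\<lambda>z. z * unit_convolution f g z))"
  by (simp add: duhamel_def contour_convolution_eq)

lemma unit_convolution_cong:
  assumes "\<And>w. w \<in> ball 0 r \<Longrightarrow> f w = f' w" "\<And>w. w \<in> ball 0 r \<Longrightarrow> g w = g' w" "z \<in> ball 0 r"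
  shows "unit_convolution f g z = unit_convolution f' g' z"
  unfolding unit_convolution_def
  using assms of_real_unit_mult_in_ball[OF assms(3)] by (intro integral_cong) metis

text \<open>The segment from 0 to a point of the disc stays in the disc, and the disc is open, so
  the derivative sees no values outside. This allows zero extensions to be exchanged for
  unrestricted functions.\<close>

lemma duhamel_cong:
  assumes "\<And>w. w \<in> ball 0 1 \<Longrightarrow> f w = f' w" "\<And>w. w \<in> ball 0 1 \<Longrightarrow> g w = g' w"
  shows "f \<circledast> g = f' \<circledast> g'"
proof -
  have "deriv (\<lambda>z. z * unit_convolution f g z) z = deriv (\<lambda>z. z * unit_convolution f' g' z) z"
    if "z \<in> ball 0 1" for z
    using that unit_convolution_cong[of 1 f f' g g'] assms
    by (intro deriv_cong_ev eventually_nhds_in_open[THEN eventually_mono, of "ball 0 1"]) auto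
  then show ?thesis by (auto simp: duhamel_eq on_disc_def)
qed

text \<open>As \<open>z\<close> vanishes at 0 and has derivative 1, the derivative formula reduces
  the product to \<open>z\<close> times the integral of \<open>s * z\<close> over the unit
  interval.\<close>

lemma duhamel_id_id:
  "(\<lambda>z. z) \<circledast> (\<lambda>z. z) = on_disc (\<lambda>z. z\<^sup>2 / 2)"
proof -
  have "deriv (\<lambda>z. z * unit_convolution (\<lambda>z. z) (\<lambda>z. z) z) z = z\<^sup>2 / 2" if "z \<in> ball 0 1" for z :: complex
  proof -
    have "((\<lambda>s::real. of_real s * z) has_integral of_real 1 ^ 2 / 2 * z - of_real 0 ^ 2 / 2 * z) {0..1}"
    proof (rule fundamental_theorem_of_calculus)
      fix s :: real
      have "((\<lambda>w. w ^ 2 / 2 * z) has_field_derivative of_real s * z) (at (of_real s))"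
        by (auto intro!: derivative_eq_intros)
      then show "((\<lambda>s. of_real s ^ 2 / 2 * z) has_vector_derivative of_real s * z) (at s within {0..1})"
        using has_vector_derivative_real_field[of "\<lambda>w. w ^ 2 / 2 * z"] by simp
    qed simp
    then have "((\<lambda>s::real. of_real s * z) has_integral z / 2) (cbox 0 1)" by simp
    from integral_unique[OF this] have "unit_convolution (\<lambda>_. 1) (\<lambda>z. z) z = z / 2"
      unfolding unit_convolution_def mult_1_left .
    moreover have "deriv (\<lambda>z. z) = (\<lambda>_::complex. 1)" by auto
    ultimately show ?thesis
      using that deriv_times_unit_convolution[of "\<lambda>z. z" 1 "\<lambda>z. z" z] by (simp add: power2_eq_square)
  qed
  then show ?thesis by (auto simp: duhamel_eq on_disc_def)
qed

text \<open>A dilation commutes with the rescaled convolution: dilating both factors by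
  \<open>a\<close> evaluates \<open>?G\<close> at \<open>a * z\<close>. It remains to compare the
  outer derivatives.\<close>

lemma comp_op_duhamel_linear:
  assumes f: "f holomorphic_on ball 0 1" and g: "g holomorphic_on ball 0 1" and a: "cmod a \<le> 1"
    and \<phi>: "\<And>z. z \<in> ball 0 1 \<Longrightarrow> \<phi> z = a * z"
  shows "comp_op \<phi> (f \<circledast> g) = comp_op \<phi> f \<circledast> comp_op \<phi> g"
proof -
  have in_ball: "a * z \<in> ball 0 1" if "z \<in> ball 0 1" for z
    using that a mult_left_le_one_le[of "cmod z" "cmod a"] by (simp add: norm_mult)
  let ?G = "unit_convolution f g"
  have "comp_op \<phi> f \<circledast> comp_op \<phi> g = (\<lambda>z. f (a * z)) \<circledast> (\<lambda>z. g (a * z))"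
    using \<phi> by (intro duhamel_cong) (auto simp: comp_op_def on_disc_def)
  also have "\<dots> = on_disc (deriv (\<lambda>z. z * ?G (a * z)))"
    by (simp add: duhamel_eq unit_convolution_def algebra_simps)
  also have "\<dots> = comp_op \<phi> (f \<circledast> g)"
  proof -
    \<comment> \<open>The factor \<open>a\<close> from the chain rule is absorbed by the factor
      \<open>z\<close> in front of \<open>?G\<close>. Computing both sides directly avoids dividing
      by \<open>a\<close>, so \<open>a = 0\<close> is covered.\<close>
    have "deriv (\<lambda>z. z * ?G (a * z)) z = deriv (\<lambda>z. z * ?G z) (a * z)" if "z \<in> ball 0 1" for z
    proof -
      have G: "(?G has_field_derivative deriv ?G (a * z)) (at (a * z))"
        using unit_convolution_holomorphic[OF f g] in_ball[OF that] by (auto intro: holomorphic_derivI)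
      have "((\<lambda>z. z * ?G (a * z)) has_field_derivative ?G (a * z) + a * z * deriv ?G (a * z)) (at z)"
        using DERIV_mult[OF DERIV_ident DERIV_chain2[where g = "\<lambda>z. a * z", OF G DERIV_cmult_Id]]
        by (simp add: algebra_simps)
      moreover have "((\<lambda>z. z * ?G z) has_field_derivative ?G (a * z) + a * z * deriv ?G (a * z))
          (at (a * z))"
        using DERIV_mult[OF DERIV_ident G] by (simp add: algebra_simps)
      ultimately show ?thesis by (simp add: DERIV_imp_deriv)
    qed
    then show ?thesis
      using \<phi> in_ball by (auto simp: comp_op_def duhamel_eq on_disc_def)
  qed
  finally show ?thesis ..
qed

section \<open>Rigidity of the derivatives at the origin\<close>

text \<open>Strong induction, choosing for each \<open>m\<close> an equation in which only terms
  with \<open>c m\<close> survive. The index 1 escapes because the coefficient of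
  \<open>c 1 * c 1\<close> is \<open>(2 choose 1) - 2 = 0\<close>.\<close>

lemma binomial_convolution_rigidity:
  fixes c :: "nat \<Rightarrow> complex"
  assumes eq: "\<And>n. (\<Sum>i\<le>n. (of_nat (n choose i) - 2) * (c i * c (n - i))) = 0" and "m \<noteq> 1"
  shows "c m = 0"
  using \<open>m \<noteq> 1\<close>
proof (induction m rule: less_induct)
  case (less m)
  \<comment> \<open>For \<open>n = 0\<close> the coefficient is \<open>1 - 2\<close>, so the
    equation is \<open>- (c 0 * c 0) = 0\<close>.\<close>
  have c0: "c 0 = 0" using eq[of 0] by simp
  show ?case
  proof (cases "m = 0")
    case False
    with less.prems have m: "m \<ge> 2" by simp
    have z: "c i = 0" if "i < m" "i \<noteq> 1" for i using less.IH that by blast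
    show ?thesis
    proof (cases "c 1 = 0")
      case True
      have zero: "c i = 0" if "i < m" for i using z[OF that] True by (cases "i = 1") auto
      \<comment> \<open>In degree \<open>2*m\<close> every term but the middle one has an index
        below \<open>m\<close>, so only a multiple of the square of \<open>c m\<close> is
        left.\<close>
      have "(\<Sum>i\<le>2*m. (of_nat ((2*m) choose i) - 2) * (c i * c (2*m - i)))
        = (\<Sum>i\<in>{m}. (of_nat ((2*m) choose i) - 2) * (c i * c (2*m - i)))"
      proof (rule sum.mono_neutral_right)
        show "\<forall>i\<in>{..2*m} - {m}. (of_nat ((2*m) choose i) - 2) * (c i * c (2*m - i)) = 0"
        proof
          fix i assume "i \<in> {..2*m} - {m}"
          then have "i < m \<or> 2*m - i < m" by auto
          then show "(of_nat ((2*m) choose i) - 2) * (c i * c (2*m - i)) = 0" using zero by auto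
        qed
      qed auto
      moreover have "of_nat ((2*m) choose m) \<noteq> (2::complex)"
      proof -
        have "(2::real) ^ 2 \<le> 2 ^ m" using m by (intro power_increasing) auto
        also have "\<dots> \<le> real ((2*m) choose m)"
          using binomial_ge_n_over_k_pow_k[of m "2*m", where 'a = real] m by simp
        finally have "real ((2*m) choose m) \<ge> 4" by simp
        then have "real ((2*m) choose m) \<noteq> real 2" by linarith
        then show ?thesis by (metis of_nat_eq_iff of_nat_numeral)
      qed
      ultimately show ?thesis using eq[of "2*m"] by simp
    next
      case c1: False
      \<comment> \<open>Degree \<open>Suc m\<close> pairs \<open>c m\<close> with the nonzero
        \<open>c 1\<close>. The still unknown \<open>c (Suc m)\<close> is multiplied by
        \<open>c 0 = 0\<close>.\<close>
      have "(\<Sum>i\<le>Suc m. (of_nat (Suc m choose i) - 2) * (c i * c (Suc m - i)))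
        = (\<Sum>i\<in>{1, m}. (of_nat (Suc m choose i) - 2) * (c i * c (Suc m - i)))"
      proof (rule sum.mono_neutral_right)
        show "\<forall>i\<in>{..Suc m} - {1, m}. (of_nat (Suc m choose i) - 2) * (c i * c (Suc m - i)) = 0"
        proof
          fix i assume "i \<in> {..Suc m} - {1, m}"
          then have "i < m \<and> i \<noteq> 1 \<or> i = Suc m" by auto
          then show "(of_nat (Suc m choose i) - 2) * (c i * c (Suc m - i)) = 0" using z c0 by auto
        qed
      qed auto
      also have "\<dots> = 2 * ((of_nat m - 1) * (c 1 * c m))"
      proof -
        have "Suc m choose m = Suc m" using binomial_symmetric[of m "Suc m"] by simp
        then show ?thesis using m by (simp add: algebra_simps)
      qed
      finally have "(of_nat m - 1) * (c 1 * c m) = 0" using eq[of "Suc m"] by simp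
      moreover have "of_nat m \<noteq> (1::complex)" using m by (metis less.prems of_nat_1 of_nat_eq_iff)
      ultimately show ?thesis using c1 by simp
    qed
  qed (simp add: c0)
qed

lemma duhamel_square_imp_linear:
  assumes \<phi>: "\<phi> holomorphic_on ball 0 1"
    and sq: "\<And>z. z \<in> ball 0 1 \<Longrightarrow> (\<phi> \<circledast> \<phi>) z = (\<phi> z)\<^sup>2 / 2" and z: "z \<in> ball 0 1"
  shows "\<phi> z = deriv \<phi> 0 * z"
proof -
  let ?c = "\<lambda>n. (deriv ^^ n) \<phi> 0"
  have "(\<Sum>i\<le>n. (of_nat (n choose i) - 2) * (?c i * ?c (n - i))) = 0" for n
  proof -
    have "(\<Sum>i\<le>n. of_nat (n choose i) * ?c i * ?c (n - i)) = (deriv ^^ n) (\<lambda>z. \<phi> z * \<phi> z) 0"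
      using higher_deriv_mult[OF \<phi> \<phi>, of 0 n] by (simp add: atMost_atLeast0)
    also have "\<dots> = (deriv ^^ n) (\<lambda>z. 2 * deriv (\<lambda>z. z * unit_convolution \<phi> \<phi> z) z) 0"
    proof (rule higher_deriv_transform_within_open[where S = "ball 0 1"])
      show "\<phi> w * \<phi> w = 2 * deriv (\<lambda>z. z * unit_convolution \<phi> \<phi> z) w" if "w \<in> ball 0 1" for w
        using sq[OF that] that by (simp add: duhamel_eq on_disc_def power2_eq_square mult.commute)
    qed (auto intro!: holomorphic_intros holomorphic_deriv unit_convolution_holomorphic \<phi>)
    also have "\<dots> = 2 * (deriv ^^ n) (deriv (\<lambda>z. z * unit_convolution \<phi> \<phi> z)) 0"
      by (intro higher_deriv_cmult[where A = "ball 0 1"] holomorphic_intros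
          holomorphic_deriv unit_convolution_holomorphic \<phi>) auto
    also have "\<dots> = 2 * (\<Sum>i\<le>n. ?c i * ?c (n - i))"
      using higher_deriv_duhamel_0[OF \<phi> \<phi>] by simp
    finally show ?thesis
      by (simp add: left_diff_distrib sum_subtractf sum_distrib_left mult.assoc)
  qed
  then have "?c m = 0" if "m \<noteq> 1" for m
    using binomial_convolution_rigidity[of ?c m] that by blast
  \<comment> \<open>Both sides vanish for \<open>n \<noteq> 1\<close> and agree for
    \<open>n = 1\<close>; equal derivatives at the centre give equality on the whole ball.\<close>
  then have "(deriv ^^ n) \<phi> 0 = (deriv ^^ n) (\<lambda>z. deriv \<phi> 0 * z) 0" for n
    by (cases "n = 1") auto
  then show ?thesis
    using z \<phi> holomorphic_fun_eq_on_ball[of \<phi> 0 1 "\<lambda>z. deriv \<phi> 0 * z" z]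
    by (auto intro: holomorphic_intros)
qed

lemma norm_le_1_if_mult_ball_subset:
  fixes a :: "'a::real_normed_field"
  assumes "\<And>z. z \<in> ball 0 1 \<Longrightarrow> a * z \<in> ball 0 1"
  shows "norm a \<le> 1"
proof (rule ccontr)
  assume "\<not> norm a \<le> 1"
  then have a: "norm a > 1" by simp
  \<comment> \<open>Multiplication by \<open>a\<close> sends this point to 1, outside the open
    ball.\<close>
  then have "inverse a \<in> ball 0 1" by (auto simp: norm_inverse inverse_less_1_iff)
  from assms[OF this] show False using a by (cases "a = 0") auto
qed

theorem theorem7p4:
  fixes X :: "(complex \<Rightarrow> complex) set"
    and N :: "(complex \<Rightarrow> complex) \<Rightarrow> real"
    and \<phi> :: "complex \<Rightarrow> complex"
  assumes "duhamel_banach_algebra X N"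
    and "on_disc (\<lambda>z. z) \<in> X"
    and "\<phi> holomorphic_on ball 0 1"
    and "\<phi> ` ball 0 1 \<subseteq> ball 0 1"
    and "bounded_operator_on X N (comp_op \<phi>)"
  shows "duhamel_multiplicative_on X (comp_op \<phi>) \<longleftrightarrow>
    (\<exists>a. cmod a \<le> 1 \<and> (\<forall>z\<in>ball 0 1. \<phi> z = a * z))"
proof
  assume "duhamel_multiplicative_on X (comp_op \<phi>)"
  \<comment> \<open>The single pair \<open>(z, z)\<close> suffices, because composing
    \<open>z\<close> with \<phi> returns \<phi> itself on the disc.\<close>
  then have "comp_op \<phi> (on_disc (\<lambda>z. z) \<circledast> on_disc (\<lambda>z. z))
      = comp_op \<phi> (on_disc (\<lambda>z. z)) \<circledast> comp_op \<phi> (on_disc (\<lambda>z. z))"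
    using assms(2) by (auto simp: duhamel_multiplicative_on_def)
  also have "comp_op \<phi> (on_disc (\<lambda>z. z)) \<circledast> comp_op \<phi> (on_disc (\<lambda>z. z)) = \<phi> \<circledast> \<phi>"
    using assms(4) by (intro duhamel_cong) (auto simp: comp_op_def on_disc_def image_subset_iff)
  also have "on_disc (\<lambda>z. z) \<circledast> on_disc (\<lambda>z. z) = on_disc (\<lambda>z. z\<^sup>2 / 2)"
    by (subst duhamel_id_id[symmetric], rule duhamel_cong) (auto simp: on_disc_def)
  finally have sq: "\<phi> \<circledast> \<phi> = comp_op \<phi> (on_disc (\<lambda>z. z\<^sup>2 / 2))" ..
  \<comment> \<open>As \<phi> maps the disc into itself, the cutoff in \<open>on_disc\<close> does
    not affect the value at \<open>\<phi> z\<close>.\<close>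
  have "(\<phi> \<circledast> \<phi>) z = (\<phi> z)\<^sup>2 / 2" if "z \<in> ball 0 1" for z
    unfolding sq using that assms(4) by (auto simp: comp_op_def on_disc_def image_subset_iff)
  then have lin: "\<phi> z = deriv \<phi> 0 * z" if "z \<in> ball 0 1" for z
    using duhamel_square_imp_linear[OF assms(3)] that by blast
  then have "cmod (deriv \<phi> 0) \<le> 1"
    using assms(4) by (intro norm_le_1_if_mult_ball_subset) (metis image_subset_iff)
  with lin show "\<exists>a. cmod a \<le> 1 \<and> (\<forall>z\<in>ball 0 1. \<phi> z = a * z)" by blast
next
  assume "\<exists>a. cmod a \<le> 1 \<and> (\<forall>z\<in>ball 0 1. \<phi> z = a * z)"
  then show "duhamel_multiplicative_on X (comp_op \<phi>)"
    using comp_op_duhamel_linear duhamel_banach_algebra.holomorphic[OF assms(1)]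
    unfolding duhamel_multiplicative_on_def by blast
qed

end
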